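(* Let $\alpha:I\subset\mathbb R\to E^n$ be a unit speed curve in the Euclidean space $E^n$ with curvatures $\kappa_1,\ldots,\kappa_{n-1}$, satisfying $\kappa_i(s)\neq 0$ for all $s\in I$ and $1\le i\le n-1$. Then $\alpha$ is a slant helix if and only if there exists a $C^2$-function $G_n(s)$ on $I$ such that $$G_n=\frac{1}{\kappa_{n-1}}\Big[\kappa_{n-2}G_{n-2}+G_{n-1}'\Big],\qquad \frac{dG_n}{ds}=-\kappa_{n-1}(s)\,G_{n-1}(s),$$ where (for some choice of the antiderivative $G_1$ of $\kappa_1$) $$G_1=\int\kappa_1(s)\,ds,\qquad G_2=1,\qquad G_3=\frac{\kappa_1}{\kappa_2}G_1,\qquad G_i=\frac{1}{\kappa_{i-1}}\Big[\kappa_{i-2}G_{i-2}+G_{i-1}'\Big]\quad (4\le i\le n-1).$$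
   Context: $E^n$ is $\mathbb R^n$ with the standard scalar product $\langle X,Y\rangle=\sum_{i=1}^n x_iy_i$; here $n\ge 3$, and $I\subset\mathbb R$ is an open interval. Curves and curvature functions are assumed differentiable as often as needed (smooth). A curve $\alpha$ is of unit speed if $\langle\alpha'(s),\alpha'(s)\rangle=1$ for all $s\in I$. Primes denote $d/ds$. Frenet frame: $\{V_1(s),\ldots,V_n(s)\}$ is the orthonormal moving frame along $\alpha$ with $V_1=\alpha'$ satisfying the Frenet equations $$V_1'=\kappa_1V_2,\qquad V_i'=-\kappa_{i-1}V_{i-1}+\kappa_iV_{i+1}\ (2\le i\le n-1),\qquad V_n'=-\kappa_{n-1}V_{n-1}.$$ The function $\kappa_i(s)$ is the $i$-th curvature of $\alpha$, and $V_2$ is the unit principal normal. Slant helix: a unit speed curve $\alpha:I\to E^n$ is called a slant helix if its unit principal normal $V_2$ makes a constant angle $\theta$ with a fixed direction $U$, i.e. there is a constant vector $U$ with $\langle U,U\rangle=1$ such that $\langle V_2(s),U\rangle=\cos\theta$ for all $s\in I$, with $\theta$ constant. $\int\kappa_1(s)\,ds$ denotes an indefinite integral (antiderivative) of $\kappa_1$ on $I$.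
   Formalization: The constant angle θ of a slant helix is required to satisfy cos θ ≠ 0: for a right angle the "only if" part is false (a circular helix in E^3 has V_2 orthogonal to its axis, but no G_n exists, as it would force κ_1² = −κ_2²). *)

theory Defs
  imports "HOL-Analysis.Analysis"
begin

fun C_k_on :: "nat \<Rightarrow> (real \<Rightarrow> 'a::real_normed_vector) \<Rightarrow> real set \<Rightarrow> bool" where
  "C_k_on 0 f S \<longleftrightarrow> continuous_on S f"
| "C_k_on (Suc k) f S \<longleftrightarrow>
     (\<exists>f'. (\<forall>s\<in>S. (f has_vector_derivative f' s) (at s)) \<and> C_k_on k f' S)"

definition smooth_on :: "(real \<Rightarrow> 'a::real_normed_vector) \<Rightarrow> real set \<Rightarrow> bool" where
  "smooth_on f S \<longleftrightarrow> (\<forall>k. C_k_on k f S)"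

definition unit_speed_on :: "(real \<Rightarrow> 'a::real_inner) \<Rightarrow> real set \<Rightarrow> bool" where
  "unit_speed_on \<alpha> S \<longleftrightarrow>
     (\<forall>s\<in>S. \<alpha> differentiable (at s) \<and>
        vector_derivative \<alpha> (at s) \<bullet> vector_derivative \<alpha> (at s) = 1)"

text \<open>
  Here n is \<open>CARD('n)\<close>; \<open>V i\<close> is the i-th frame field and \<open>\<kappa> i\<close> the i-th curvature.
  Only \<open>V 1, ..., V n\<close> and \<open>\<kappa> 1, ..., \<kappa> (n - 1)\<close> are constrained.
\<close>

definition frenet_frame ::
  "real set \<Rightarrow> (real \<Rightarrow> real ^ 'n) \<Rightarrow> (nat \<Rightarrow> real \<Rightarrow> real ^ 'n) \<Rightarrow> (nat \<Rightarrow> real \<Rightarrow> real) \<Rightarrow> bool"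
  where
  "frenet_frame I \<alpha> V \<kappa> \<longleftrightarrow> (let n = CARD('n) in
     (\<forall>s\<in>I. \<forall>i\<in>{1..n}. \<forall>j\<in>{1..n}. V i s \<bullet> V j s = (if i = j then 1 else 0)) \<and>
     (\<forall>s\<in>I. (\<alpha> has_vector_derivative V 1 s) (at s)) \<and>
     (\<forall>s\<in>I. (V 1 has_vector_derivative \<kappa> 1 s *\<^sub>R V 2 s) (at s)) \<and>
     (\<forall>i\<in>{2..n - 1}. \<forall>s\<in>I. (V i has_vector_derivative
        (- \<kappa> (i - 1) s *\<^sub>R V (i - 1) s + \<kappa> i s *\<^sub>R V (i + 1) s)) (at s)) \<and>
     (\<forall>s\<in>I. (V n has_vector_derivative (- \<kappa> (n - 1) s *\<^sub>R V (n - 1) s)) (at s)))"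

definition slant_helix_with_angle ::
  "real set \<Rightarrow> (nat \<Rightarrow> real \<Rightarrow> 'a::real_inner) \<Rightarrow> real \<Rightarrow> bool" where
  "slant_helix_with_angle I V \<theta> \<longleftrightarrow> (\<exists>U. U \<bullet> U = 1 \<and> (\<forall>s\<in>I. V 2 s \<bullet> U = cos \<theta>))"

text \<open>
  The right angle has to be excluded: for a circular helix in 3-space the principal normal
  is orthogonal to the axis, but \<open>\<kappa> 1 / \<kappa> 2\<close> is a nonzero constant, say r, and the conditions
  \<open>G 3 = r * G 1\<close>, \<open>(G 3)' = - \<kappa> 2\<close> would give \<open>r * \<kappa> 1 = - \<kappa> 2\<close>, that is \<open>r\<^sup>2 = -1\<close>.
\<close>

definition slant_helix ::
  "real set \<Rightarrow> (nat \<Rightarrow> real \<Rightarrow> 'a::real_inner) \<Rightarrow> bool" where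
  "slant_helix I V \<longleftrightarrow> (\<exists>\<theta>. cos \<theta> \<noteq> 0 \<and> slant_helix_with_angle I V \<theta>)"

text \<open>
  The functions \<open>G 1, ..., G (n - 1)\<close> on the open interval \<open>I\<close>, where \<open>G 1\<close> is any
  antiderivative of \<open>\<kappa> 1\<close>. For smooth nonvanishing curvatures every \<open>G i\<close> is differentiable
  on \<open>I\<close>, so \<open>deriv\<close> is the actual derivative.
\<close>

definition G_sequence ::
  "real set \<Rightarrow> nat \<Rightarrow> (nat \<Rightarrow> real \<Rightarrow> real) \<Rightarrow> (nat \<Rightarrow> real \<Rightarrow> real) \<Rightarrow> bool" where
  "G_sequence I n \<kappa> G \<longleftrightarrow>
     (\<forall>s\<in>I. (G 1 has_real_derivative \<kappa> 1 s) (at s)) \<and>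
     (\<forall>s\<in>I. G 2 s = 1) \<and>
     (\<forall>s\<in>I. G 3 s = \<kappa> 1 s / \<kappa> 2 s * G 1 s) \<and>
     (\<forall>i\<in>{4..n - 1}. \<forall>s\<in>I.
        G i s = 1 / \<kappa> (i - 1) s * (\<kappa> (i - 2) s * G (i - 2) s + deriv (G (i - 1)) s))"

end

theory Submission
  imports Defs
begin

text \<open>
  With \<open>k i = \<kappa> i\<close> for \<open>1 \<le> i < n\<close> and \<open>k i = 0\<close> otherwise, the Frenet equations
  read \<open>V\<^sub>i' = k\<^sub>i V\<^sub>i\<^sub>+\<^sub>1 - k\<^sub>i\<^sub>-\<^sub>1 V\<^sub>i\<^sub>-\<^sub>1\<close>. The conditions on \<open>G\<close> say
  precisely that \<open>G\<close> solves the same system with \<open>G\<^sub>2 = 1\<close>. Since the system is skew-symmetric,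
  \<open>\<Sum> G\<^sub>i V\<^sub>i\<close> is then a constant vector, whose normalisation is the axis of the helix.
  Conversely, the components \<open>\<langle>V\<^sub>i, U\<rangle>\<close> of an axis solve the system, and dividing
  by \<open>\<langle>V\<^sub>2, U\<rangle> = cos \<theta> \<noteq> 0\<close> makes the second one equal to 1.
\<close>

section \<open>Closure properties of functions with finitely many continuous derivatives\<close>

lemma C_k_on_continuous_on: "C_k_on k f S \<Longrightarrow> continuous_on S f"
proof (cases k)
  case (Suc m)
  assume "C_k_on k f S"
  then have "f differentiable at s" if "s \<in> S" for s
    using that Suc by (auto intro: differentiableI_vector)
  then show ?thesis
    by (simp add: continuous_at_imp_continuous_on differentiable_imp_continuous_within)
qed simp

lemma C_k_on_SucD: "C_k_on (Suc k) f S \<Longrightarrow> C_k_on k f S"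
proof (induction k arbitrary: f)
  case 0
  then show ?case using C_k_on_continuous_on[OF 0] by simp
next
  case (Suc k)
  from Suc.prems obtain f' where "\<forall>s\<in>S. (f has_vector_derivative f' s) (at s)" "C_k_on (Suc k) f' S"
    unfolding C_k_on.simps(2)[of "Suc k"] by blast
  with Suc.IH show ?case unfolding C_k_on.simps(2)[of k f] by blast
qed

text \<open>Openness lets agreement on \<open>S\<close> carry over to the derivatives, which are
  taken along the whole line and not within \<open>S\<close>.\<close>

lemma C_k_on_cong:
  assumes "open S" "\<And>s. s \<in> S \<Longrightarrow> f s = g s"
  shows "C_k_on k f S \<longleftrightarrow> C_k_on k g S"
proof (cases k)
  case 0
  then show ?thesis using assms(2) by (auto cong: continuous_on_cong)
next
  case (Suc m)
  have "(f has_vector_derivative d) (at s) \<longleftrightarrow> (g has_vector_derivative d) (at s)"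
    if "s \<in> S" for s d
    using has_vector_derivative_transform_within_open[OF _ assms(1) that] assms(2) by metis
  then show ?thesis using Suc by simp
qed

lemma C_k_on_const: "C_k_on k (\<lambda>_. c) S"
proof (induction k arbitrary: c)
  case (Suc k)
  show ?case using Suc[of 0] by (auto intro!: exI[of _ "\<lambda>_. 0"])
qed simp

lemma C_k_on_add: "C_k_on k f S \<Longrightarrow> C_k_on k g S \<Longrightarrow> C_k_on k (\<lambda>s. f s + g s) S"
proof (induction k arbitrary: f g)
  case 0
  then show ?case by (simp add: continuous_on_add)
next
  case (Suc k)
  then obtain f' g' where
    "\<forall>s\<in>S. (f has_vector_derivative f' s) (at s)" "C_k_on k f' S"
    "\<forall>s\<in>S. (g has_vector_derivative g' s) (at s)" "C_k_on k g' S"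
    by auto
  then show ?case using Suc.IH[of f' g']
    by (auto intro!: exI[of _ "\<lambda>s. f' s + g' s"] has_vector_derivative_add)
qed

lemma C_k_on_mult:
  fixes f g :: "real \<Rightarrow> 'a::real_normed_algebra"
  shows "C_k_on k f S \<Longrightarrow> C_k_on k g S \<Longrightarrow> C_k_on k (\<lambda>s. f s * g s) S"
proof (induction k arbitrary: f g)
  case 0
  then show ?case by (simp add: continuous_on_mult)
next
  case (Suc k)
  then obtain f' g' where
    d: "\<forall>s\<in>S. (f has_vector_derivative f' s) (at s)" "C_k_on k f' S"
    "\<forall>s\<in>S. (g has_vector_derivative g' s) (at s)" "C_k_on k g' S"
    by auto
  have "C_k_on k (\<lambda>s. f s * g' s + f' s * g s) S"
    using Suc.prems[THEN C_k_on_SucD] d by (intro C_k_on_add Suc.IH)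
  then show ?case using d
    by (auto intro!: exI[of _ "\<lambda>s. f s * g' s + f' s * g s"] has_vector_derivative_mult)
qed

lemma C_k_on_diff:
  fixes f g :: "real \<Rightarrow> 'a::real_normed_algebra_1"
  assumes "C_k_on k f S" "C_k_on k g S"
  shows "C_k_on k (\<lambda>s. f s - g s) S"
  using C_k_on_add[OF assms(1) C_k_on_mult[OF C_k_on_const[of k "- 1"] assms(2)]] by simp

lemma C_k_on_inverse:
  fixes f :: "real \<Rightarrow> real"
  assumes "\<And>s. s \<in> S \<Longrightarrow> f s \<noteq> 0"
  shows "C_k_on k f S \<Longrightarrow> C_k_on k (\<lambda>s. inverse (f s)) S"
proof (induction k)
  case 0
  then show ?case using assms by (simp add: continuous_on_inverse)
next
  case (Suc k)
  then obtain f' where d: "\<And>s. s \<in> S \<Longrightarrow> (f has_vector_derivative f' s) (at s)"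
    and f': "C_k_on k f' S"
    by auto
  \<comment> \<open>The usual derivative of a reciprocal, written as a product with constant factor
    -1 so that closure under multiplication and the induction hypothesis apply.\<close>
  let ?g = "\<lambda>s. (- 1) * (inverse (f s) * f' s * inverse (f s))"
  have "C_k_on k ?g S"
    by (intro C_k_on_mult C_k_on_const f' Suc.IH C_k_on_SucD[OF Suc.prems])
  moreover have "((\<lambda>s. inverse (f s)) has_vector_derivative ?g s) (at s)" if "s \<in> S" for s
    using DERIV_inverse'[of f "f' s"] d[OF that] assms[OF that]
    by (simp add: has_real_derivative_iff_has_vector_derivative)
  ultimately show ?case unfolding C_k_on.simps by (intro exI[of _ ?g]) blast
qed

text \<open>Derivatives are unique, so the witness inside \<open>C_k_on\<close> agrees with
  \<open>deriv f\<close> on \<open>S\<close>; outside \<open>S\<close> the two may differ.\<close>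

lemma C_k_on_deriv:
  fixes f :: "real \<Rightarrow> real"
  assumes "open S" "C_k_on (Suc k) f S"
  shows "C_k_on k (deriv f) S"
proof -
  obtain f' where d: "\<And>s. s \<in> S \<Longrightarrow> (f has_vector_derivative f' s) (at s)"
    and f': "C_k_on k f' S"
    using assms(2) by auto
  have "f' s = deriv f s" if "s \<in> S" for s
    using d[OF that] by (simp add: DERIV_imp_deriv flip: has_real_derivative_iff_has_vector_derivative)
  then show ?thesis using C_k_on_cong[OF assms(1), of f' "deriv f"] f' by simp
qed

lemma smooth_on_has_derivative:
  fixes f :: "real \<Rightarrow> real"
  assumes "smooth_on f S" "s \<in> S"
  shows "(f has_real_derivative deriv f s) (at s)"
proof -
  have "C_k_on (Suc 0) f S" using assms(1) unfolding smooth_on_def by blast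
  then obtain f' where "(f has_real_derivative f' s) (at s)"
    using assms(2) by (auto simp: has_real_derivative_iff_has_vector_derivative)
  then show ?thesis using DERIV_imp_deriv by metis
qed

lemma smooth_on_antiderivative:
  assumes "\<And>s. s \<in> S \<Longrightarrow> (f has_vector_derivative g s) (at s)" "smooth_on g S"
  shows "smooth_on f S"
proof -
  have "C_k_on (Suc k) f S" for k using assms by (auto simp: smooth_on_def)
  then show ?thesis unfolding smooth_on_def using C_k_on_SucD by blast
qed

section \<open>The Frenet equations as a skew-symmetric linear system\<close>

text \<open>Extending the curvatures by zero gives the first and last Frenet equations the same form
  as the others: the out-of-range terms \<open>X 0\<close> and \<open>X (n + 1)\<close> get
  coefficient 0.\<close>

definition coupling :: "nat \<Rightarrow> (nat \<Rightarrow> real \<Rightarrow> real) \<Rightarrow> nat \<Rightarrow> real \<Rightarrow> real" where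
  "coupling n \<kappa> i = (if i \<in> {1..n - 1} then \<kappa> i else (\<lambda>_. 0))"

text \<open>The value type is general so that one system covers both the frame vectors and real
  coefficient functions.\<close>

definition frenet_solution ::
  "real set \<Rightarrow> nat \<Rightarrow> (nat \<Rightarrow> real \<Rightarrow> real) \<Rightarrow> (nat \<Rightarrow> real \<Rightarrow> 'a::real_normed_vector) \<Rightarrow> bool" where
  "frenet_solution I n \<kappa> X \<longleftrightarrow> (\<forall>i\<in>{1..n}. \<forall>s\<in>I. (X i has_vector_derivative
     (coupling n \<kappa> i s *\<^sub>R X (i + 1) s - coupling n \<kappa> (i - 1) s *\<^sub>R X (i - 1) s)) (at s))"

lemma coupling_simps:
  "coupling n \<kappa> 0 s = 0" "coupling n \<kappa> n s = 0"
  "1 \<le> i \<Longrightarrow> i < n \<Longrightarrow> coupling n \<kappa> i s = \<kappa> i s"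
  by (auto simp: coupling_def)

lemma frenet_solution_frame:
  fixes V :: "nat \<Rightarrow> real \<Rightarrow> real ^ 'n"
  assumes "frenet_frame I \<alpha> V \<kappa>" "CARD('n) \<ge> 2"
  shows "frenet_solution I (CARD('n)) \<kappa> V"
  unfolding frenet_solution_def
proof (intro ballI)
  let ?n = "CARD('n)"
  fix i s assume i: "i \<in> {1..?n}" and s: "s \<in> I"
  note F = assms(1)[unfolded frenet_frame_def Let_def]
  consider "i = 1" | "i \<in> {2..?n - 1}" | "i = ?n" "i \<noteq> 1" using i by fastforce
  then show "(V i has_vector_derivative (coupling ?n \<kappa> i s *\<^sub>R V (i + 1) s
      - coupling ?n \<kappa> (i - 1) s *\<^sub>R V (i - 1) s)) (at s)"
  proof cases
    case 1
    then show ?thesis using F s assms(2) by (simp add: coupling_simps numeral_2_eq_2)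
  next
    case 2
    then have "(V i has_vector_derivative (- \<kappa> (i - 1) s *\<^sub>R V (i - 1) s
        + \<kappa> i s *\<^sub>R V (i + 1) s)) (at s)" using F s by blast
    moreover have "coupling ?n \<kappa> i s = \<kappa> i s" "coupling ?n \<kappa> (i - 1) s = \<kappa> (i - 1) s"
      using 2 by (auto simp: coupling_def)
    ultimately show ?thesis by (simp add: algebra_simps)
  next
    case 3
    then have "coupling ?n \<kappa> (i - 1) s = \<kappa> (i - 1) s"
      using assms(2) by (auto simp: coupling_def)
    then show ?thesis using F s 3 by (simp add: coupling_simps)
  qed
qed

text \<open>The system is linear with scalar coefficients, so a bounded linear map, here the inner
  product with \<open>U\<close> divided by \<open>c\<close>, sends solutions to solutions.\<close>

lemma frenet_solution_inner:
  fixes V :: "nat \<Rightarrow> real \<Rightarrow> 'a::real_inner"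
  assumes "frenet_solution I n \<kappa> V"
  shows "frenet_solution I n \<kappa> (\<lambda>i s. (V i s \<bullet> U) / c)"
  unfolding frenet_solution_def
proof (intro ballI)
  fix i s assume "i \<in> {1..n}" "s \<in> I"
  then have "(V i has_vector_derivative
      (coupling n \<kappa> i s *\<^sub>R V (i + 1) s - coupling n \<kappa> (i - 1) s *\<^sub>R V (i - 1) s)) (at s)"
    using assms unfolding frenet_solution_def by blast
  from bounded_linear.has_vector_derivative[OF
      bounded_linear_compose[OF bounded_linear_divide bounded_linear_inner_left] this, of U c]
  show "((\<lambda>s. (V i s \<bullet> U) / c) has_vector_derivative
      (coupling n \<kappa> i s *\<^sub>R ((V (i + 1) s \<bullet> U) / c)
        - coupling n \<kappa> (i - 1) s *\<^sub>R ((V (i - 1) s \<bullet> U) / c))) (at s)"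
    by (simp add: inner_diff_left diff_divide_distrib)
qed

text \<open>Bootstrapping: each derivative is a combination of the functions \<open>G j\<close> with
  smooth coefficients, so a regularity order shared by all of them can be raised by one.\<close>

lemma frenet_solution_smooth:
  fixes G :: "nat \<Rightarrow> real \<Rightarrow> real"
  assumes sol: "frenet_solution I n \<kappa> G"
    and \<kappa>: "\<And>i. i \<in> {1..n - 1} \<Longrightarrow> smooth_on (\<kappa> i) I"
    and i: "i \<in> {1..n}"
  shows "C_k_on k (G i) I"
  using i
proof (induction k arbitrary: i)
  case 0
  then show ?case using sol unfolding frenet_solution_def
    by (auto intro!: continuous_at_imp_continuous_on has_vector_derivative_continuous)
next
  case (Suc k)
  \<comment> \<open>The index \<open>m\<close> needs to be in range only where the coupling is a
    curvature. Elsewhere the product is identically 0, which disposes of \<open>G 0\<close> and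
    \<open>G (n + 1)\<close>, about whose regularity nothing is known.\<close>
  have *: "C_k_on k (\<lambda>s. coupling n \<kappa> j s * G m s) I"
    if "j \<in> {1..n - 1} \<Longrightarrow> m \<in> {1..n}" for j m
  proof (cases "j \<in> {1..n - 1}")
    case True
    then show ?thesis using that \<kappa> Suc.IH
      by (auto simp: coupling_def smooth_on_def intro: C_k_on_mult)
  next
    case False
    show ?thesis unfolding coupling_def if_not_P[OF False] by (simp add: C_k_on_const)
  qed
  let ?d = "\<lambda>s. coupling n \<kappa> i s * G (i + 1) s - coupling n \<kappa> (i - 1) s * G (i - 1) s"
  have "C_k_on k ?d I"
    using Suc.prems by (intro C_k_on_diff *) auto
  moreover have "\<forall>s\<in>I. (G i has_vector_derivative ?d s) (at s)"
    using sol Suc.prems by (simp add: frenet_solution_def)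
  ultimately show ?case unfolding C_k_on.simps by (intro exI[of _ ?d] conjI)
qed

text \<open>By the product rule and skew-symmetry, the derivative of the \<open>i\<close>-th summand
  is a difference \<open>?b i - ?b (i - 1)\<close>. The sum telescopes, and both boundary terms
  vanish because the coupling is 0 at the indices 0 and \<open>n\<close>.\<close>

lemma frenet_solution_sum_constant:
  fixes V :: "nat \<Rightarrow> real \<Rightarrow> 'a::real_normed_vector" and G :: "nat \<Rightarrow> real \<Rightarrow> real"
  assumes V: "frenet_solution I n \<kappa> V" and G: "frenet_solution I n \<kappa> G" and "is_interval I"
  obtains W where "\<And>s. s \<in> I \<Longrightarrow> (\<Sum>i=1..n. G i s *\<^sub>R V i s) = W"
proof -
  let ?k = "coupling n \<kappa>"
  have "((\<lambda>s. \<Sum>i=1..n. G i s *\<^sub>R V i s) has_vector_derivative 0) (at s)" if s: "s \<in> I" for s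
  proof -
    let ?b = "\<lambda>i. ?k i s *\<^sub>R (G (Suc i) s *\<^sub>R V i s + G i s *\<^sub>R V (Suc i) s)"
    have "((\<lambda>s. G i s *\<^sub>R V i s) has_vector_derivative (?b i - ?b (i - 1))) (at s)"
      if i: "i \<in> {1..n}" for i
    proof -
      \<comment> \<open>Matches the shifted index inside \<open>?b (i - 1)\<close>; under truncated
        subtraction this depends on \<open>i\<close> being positive.\<close>
      have "Suc (i - 1) = i" using i by auto
      moreover have "(G i has_real_derivative
          ?k i s * G (i + 1) s - ?k (i - 1) s * G (i - 1) s) (at s)"
        using G i s unfolding frenet_solution_def has_real_derivative_iff_has_vector_derivative by simp
      moreover have "(V i has_vector_derivative
          (?k i s *\<^sub>R V (i + 1) s - ?k (i - 1) s *\<^sub>R V (i - 1) s)) (at s)"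
        using V i s unfolding frenet_solution_def by blast
      ultimately show ?thesis
        using has_vector_derivative_scaleR[of "G i" _ s UNIV "V i"]
        by (fastforce simp: algebra_simps)
    qed
    then have "((\<lambda>s. \<Sum>i=1..n. G i s *\<^sub>R V i s) has_vector_derivative
        (\<Sum>i=1..n. ?b i - ?b (i - 1))) (at s)"
      by (intro has_vector_derivative_sum)
    moreover have "(\<Sum>i=1..n. ?b i - ?b (i - 1)) = ?b n - ?b 0"
      using sum_telescope''[of 0 n ?b] by simp
    ultimately show ?thesis by (simp add: coupling_simps)
  qed
  then obtain W where "\<And>s. s \<in> I \<Longrightarrow> (\<Sum>i=1..n. G i s *\<^sub>R V i s) = W"
    using has_vector_derivative_zero_constant[OF is_interval_convex[OF assms(3)]
        has_vector_derivative_at_within] by blast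
  then show ?thesis by (rule that)
qed

section \<open>Smoothness of the functions given by the recursion\<close>

text \<open>Every recursion step differentiates once and so costs one order of regularity; the
  induction therefore carries all orders together. The result makes \<open>deriv\<close> in the
  recursion a genuine derivative.\<close>

lemma G_sequence_smooth:
  assumes G: "G_sequence I n \<kappa> G"
    and "open I" "n \<ge> 3"
    and \<kappa>: "\<And>i. i \<in> {1..n - 1} \<Longrightarrow> smooth_on (\<kappa> i) I"
    and nz: "\<And>i s. i \<in> {1..n - 1} \<Longrightarrow> s \<in> I \<Longrightarrow> \<kappa> i s \<noteq> 0"
    and "i \<in> {1..n - 1}"
  shows "smooth_on (G i) I"
  using \<open>i \<in> {1..n - 1}\<close>
proof (induction i rule: less_induct)
  case (less i)
  note G' = G[unfolded G_sequence_def]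
  have inv: "C_k_on k (\<lambda>s. inverse (\<kappa> j s)) I" if "j \<in> {1..n - 1}" for j k
    using that \<kappa> nz unfolding smooth_on_def by (intro C_k_on_inverse) auto
  have G1: "smooth_on (G 1) I"
    using G' \<open>n \<ge> 3\<close> \<kappa>[of 1]
    by (intro smooth_on_antiderivative[of I "G 1" "\<kappa> 1"])
      (auto simp: has_real_derivative_iff_has_vector_derivative)
  consider "i = 1" | "i = 2" | "i = 3" | "i \<in> {4..n - 1}" using less.prems by fastforce
  then show ?case
  proof cases
    case 1
    then show ?thesis using G1 by simp
  next
    case 2
    then show ?thesis
      using G' C_k_on_cong[OF \<open>open I\<close>, of "G 2" "\<lambda>_. 1"]
      by (simp add: smooth_on_def C_k_on_const)
  next
    case 3
    have "C_k_on k (\<lambda>s. \<kappa> 1 s * inverse (\<kappa> 2 s) * G 1 s) I" for k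
      using G1 \<kappa>[of 1] inv[of 2] less.prems 3 by (intro C_k_on_mult) (auto simp: smooth_on_def)
    then show ?thesis
      using 3 G' C_k_on_cong[OF \<open>open I\<close>, of "G 3" "\<lambda>s. \<kappa> 1 s * inverse (\<kappa> 2 s) * G 1 s"]
      by (simp add: smooth_on_def divide_inverse)
  next
    case 4
    let ?f = "\<lambda>s. inverse (\<kappa> (i - 1) s) * (\<kappa> (i - 2) s * G (i - 2) s + deriv (G (i - 1)) s)"
    have "i - 1 \<in> {1..n - 1}" "i - 2 \<in> {1..n - 1}" "i - 1 < i" "i - 2 < i" using 4 by auto
    then have "C_k_on k ?f I" for k
      using inv \<kappa>[of "i - 2"] less.IH[of "i - 2"] less.IH[of "i - 1"]
      by (intro C_k_on_mult C_k_on_add C_k_on_deriv \<open>open I\<close>) (auto simp: smooth_on_def)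
    moreover have "G i s = ?f s" if "s \<in> I" for s
      using G' 4 that by (simp add: divide_inverse)
    ultimately show ?thesis
      using C_k_on_cong[OF \<open>open I\<close>, of "G i" ?f] by (simp add: smooth_on_def)
  qed
qed

lemma has_derivative_0_if_constant_on:
  fixes f :: "real \<Rightarrow> real"
  assumes "open I" "s \<in> I" "\<And>t. t \<in> I \<Longrightarrow> f t = c"
  shows "(f has_real_derivative 0) (at s)"
  by (rule has_field_derivative_transform_within_open[OF DERIV_const assms(1,2)]) (simp add: assms(3))

section \<open>Equivalence of the recursion with the linear system\<close>

text \<open>As no curvature vanishes, the \<open>i\<close>-th equation with \<open>i < n\<close> can
  be solved for \<open>G (i + 1)\<close>, which yields the recursion. With \<open>G 2 = 1\<close>
  the first equation makes \<open>G 1\<close> an antiderivative of \<open>\<kappa> 1\<close>; the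
  last one is the condition on the derivative of \<open>G n\<close>.\<close>

lemma frenet_solution_iff_G_sequence:
  fixes G :: "nat \<Rightarrow> real \<Rightarrow> real"
  assumes "n \<ge> 3" "open I"
    and \<kappa>: "\<And>i. i \<in> {1..n - 1} \<Longrightarrow> smooth_on (\<kappa> i) I"
    and nz: "\<And>i s. i \<in> {1..n - 1} \<Longrightarrow> s \<in> I \<Longrightarrow> \<kappa> i s \<noteq> 0"
  shows "frenet_solution I n \<kappa> G \<and> (\<forall>s\<in>I. G 2 s = 1) \<longleftrightarrow>
    G_sequence I n \<kappa> G \<and>
    (\<forall>s\<in>I. G n s = 1 / \<kappa> (n - 1) s * (\<kappa> (n - 2) s * G (n - 2) s + deriv (G (n - 1)) s)) \<and>
    (\<forall>s\<in>I. (G n has_real_derivative - \<kappa> (n - 1) s * G (n - 1) s) (at s))"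
    (is "?L \<longleftrightarrow> ?S \<and> ?N \<and> ?D")
proof
  assume L: ?L
  then have d: "(G i has_real_derivative coupling n \<kappa> i s * G (i + 1) s
      - coupling n \<kappa> (i - 1) s * G (i - 1) s) (at s)" if "i \<in> {1..n}" "s \<in> I" for i s
    using that by (simp add: frenet_solution_def has_real_derivative_iff_has_vector_derivative)
  \<comment> \<open>The range 3 to \<open>n\<close> covers at once the formula for
    \<open>G 3\<close>, the recursion proper and the closing condition on
    \<open>G n\<close>.\<close>
  have rec: "G i s = 1 / \<kappa> (i - 1) s * (\<kappa> (i - 2) s * G (i - 2) s + deriv (G (i - 1)) s)"
    if "i \<in> {3..n}" "s \<in> I" for i s
  proof -
    define j where "j = i - 2"
    with that(1) have j: "i = Suc (Suc j)" "1 \<le> j" by auto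
    have "deriv (G (Suc j)) s = \<kappa> (Suc j) s * G i s - \<kappa> j s * G j s"
      using DERIV_imp_deriv[OF d[of "Suc j" s]] that j by (simp add: coupling_simps)
    moreover have "\<kappa> (Suc j) s \<noteq> 0" using nz[of "Suc j" s] that j by auto
    ultimately show ?thesis using j by simp
  qed
  have "(G 1 has_real_derivative \<kappa> 1 s) (at s)" if "s \<in> I" for s
    using d[of 1 s] that L \<open>n \<ge> 3\<close> by (simp add: coupling_simps numeral_2_eq_2)
  \<comment> \<open>The derivative of the constant \<open>G 2\<close> drops out of the general
    recursion at index 3.\<close>
  moreover have "G 3 s = \<kappa> 1 s / \<kappa> 2 s * G 1 s" if "s \<in> I" for s
    using rec[of 3 s] that \<open>n \<ge> 3\<close> L
      DERIV_imp_deriv[OF has_derivative_0_if_constant_on[OF \<open>open I\<close> that, of "G 2" 1]] by simp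
  moreover have "G i s = 1 / \<kappa> (i - 1) s * (\<kappa> (i - 2) s * G (i - 2) s + deriv (G (i - 1)) s)"
    if "i \<in> {4..n - 1}" "s \<in> I" for i s
    using that by (intro rec) auto
  ultimately have ?S using L unfolding G_sequence_def by blast
  moreover have ?D using d[of n] \<open>n \<ge> 3\<close> by (simp add: coupling_simps)
  moreover have ?N using rec[of n] \<open>n \<ge> 3\<close> by simp
  ultimately show "?S \<and> ?N \<and> ?D" by blast
next
  assume R: "?S \<and> ?N \<and> ?D"
  then have S: ?S and N: ?N and D: ?D by auto
  note S' = S[unfolded G_sequence_def]
  have "(G i has_real_derivative coupling n \<kappa> i s * G (i + 1) s
      - coupling n \<kappa> (i - 1) s * G (i - 1) s) (at s)" if i: "i \<in> {1..n}" and s: "s \<in> I" for i s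
  proof -
    consider "i = 1" | "i = 2" | "i \<in> {3..n - 1}" | "i = n" using i by fastforce
    then show ?thesis
    proof cases
      case 1
      then show ?thesis using S' s \<open>n \<ge> 3\<close> by (simp add: coupling_simps numeral_2_eq_2)
    next
      case 2
      \<comment> \<open>Both sides of the second equation are 0: \<open>G 2\<close> is constant, and
        the formula for \<open>G 3\<close> cancels the two terms on the right.\<close>
      have "G 3 s = \<kappa> 1 s / \<kappa> 2 s * G 1 s" using S' s by blast
      moreover have "(G 2 has_real_derivative 0) (at s)"
        using has_derivative_0_if_constant_on[OF \<open>open I\<close> s, of "G 2" 1] S' by blast
      moreover have "\<kappa> 2 s \<noteq> 0" using nz s \<open>n \<ge> 3\<close> by simp
      ultimately show ?thesis using 2 \<open>n \<ge> 3\<close> by (simp add: coupling_simps)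
    next
      case 3
      have "(G i has_real_derivative deriv (G i) s) (at s)"
        using smooth_on_has_derivative[OF G_sequence_smooth[OF S \<open>open I\<close> \<open>n \<ge> 3\<close> \<kappa> nz] s] 3
        by simp
      \<comment> \<open>The recursion is needed one index higher; at \<open>i + 1 = n\<close> it
        comes from the separate condition on \<open>G n\<close>.\<close>
      moreover have "G (i + 1) s = 1 / \<kappa> i s * (\<kappa> (i - 1) s * G (i - 1) s + deriv (G i) s)"
      proof (cases "i + 1 = n")
        case True
        then have "n - 1 = i" "n - 2 = i - 1" by auto
        then show ?thesis using N s True by simp
      next
        case False
        then have "i + 1 \<in> {4..n - 1}" using 3 by auto
        then have "G (i + 1) s = 1 / \<kappa> (i + 1 - 1) s *
            (\<kappa> (i + 1 - 2) s * G (i + 1 - 2) s + deriv (G (i + 1 - 1)) s)"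
          using S' s by blast
        then show ?thesis by simp
      qed
      moreover have "\<kappa> i s \<noteq> 0" using nz s 3 by simp
      moreover have "coupling n \<kappa> i s = \<kappa> i s" "coupling n \<kappa> (i - 1) s = \<kappa> (i - 1) s"
        using 3 by (auto simp: coupling_def)
      ultimately show ?thesis by simp
    next
      case 4
      then show ?thesis using D s \<open>n \<ge> 3\<close> by (simp add: coupling_simps)
    qed
  qed
  then show ?L
    using S' by (simp add: frenet_solution_def has_real_derivative_iff_has_vector_derivative)
qed

section \<open>Passage between axes of the helix and solutions with \<open>G 2 = 1\<close>\<close>

theorem theorem3p1:
  fixes I :: "real set"
    and \<alpha> :: "real \<Rightarrow> real ^ 'n"
    and V :: "nat \<Rightarrow> real \<Rightarrow> real ^ 'n"
    and \<kappa> :: "nat \<Rightarrow> real \<Rightarrow> real"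
    and n :: nat
  assumes n_def: "n = CARD('n)"
    and n_ge: "n \<ge> 3"
    and open_I: "open I"
    and interval_I: "is_interval I"
    and smooth_curve: "smooth_on \<alpha> I"
    and unit_speed: "unit_speed_on \<alpha> I"
    and smooth_curvatures: "\<And>i. i \<in> {1..n - 1} \<Longrightarrow> smooth_on (\<kappa> i) I"
    and frenet: "frenet_frame I \<alpha> V \<kappa>"
    and curvatures_nz: "\<And>i s. i \<in> {1..n - 1} \<Longrightarrow> s \<in> I \<Longrightarrow> \<kappa> i s \<noteq> 0"
  shows "slant_helix I V \<longleftrightarrow>
    (\<exists>G. G_sequence I n \<kappa> G \<and>
         C_k_on 2 (G n) I \<and>
         (\<forall>s\<in>I. G n s = 1 / \<kappa> (n - 1) s *
             (\<kappa> (n - 2) s * G (n - 2) s + deriv (G (n - 1)) s)) \<and>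
         (\<forall>s\<in>I. (G n has_real_derivative - \<kappa> (n - 1) s * G (n - 1) s) (at s)))"
proof -
  note iff = frenet_solution_iff_G_sequence[where \<kappa> = \<kappa>, OF n_ge open_I smooth_curvatures curvatures_nz]
  have V: "frenet_solution I n \<kappa> V"
    using frenet_solution_frame[OF frenet] n_def n_ge by simp
  show ?thesis
  proof
    assume "slant_helix I V"
    then obtain \<theta> U where "cos \<theta> \<noteq> 0" and U: "\<forall>s\<in>I. V 2 s \<bullet> U = cos \<theta>"
      unfolding slant_helix_def slant_helix_with_angle_def by blast
    define G where "G = (\<lambda>i s. (V i s \<bullet> U) / cos \<theta>)"
    have G: "frenet_solution I n \<kappa> G"
      unfolding G_def by (rule frenet_solution_inner[OF V])
    moreover have "\<forall>s\<in>I. G 2 s = 1" using U \<open>cos \<theta> \<noteq> 0\<close> by (simp add: G_def)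
    moreover have "C_k_on 2 (G n) I"
      using frenet_solution_smooth[OF G smooth_curvatures] n_ge by simp
    ultimately show "\<exists>G. G_sequence I n \<kappa> G \<and> C_k_on 2 (G n) I \<and>
         (\<forall>s\<in>I. G n s = 1 / \<kappa> (n - 1) s *
             (\<kappa> (n - 2) s * G (n - 2) s + deriv (G (n - 1)) s)) \<and>
         (\<forall>s\<in>I. (G n has_real_derivative - \<kappa> (n - 1) s * G (n - 1) s) (at s))"
      using iff[where G = G] by blast
  next
    assume "\<exists>G. G_sequence I n \<kappa> G \<and> C_k_on 2 (G n) I \<and>
         (\<forall>s\<in>I. G n s = 1 / \<kappa> (n - 1) s *
             (\<kappa> (n - 2) s * G (n - 2) s + deriv (G (n - 1)) s)) \<and>
         (\<forall>s\<in>I. (G n has_real_derivative - \<kappa> (n - 1) s * G (n - 1) s) (at s))"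
    then obtain G where "G_sequence I n \<kappa> G"
      "\<forall>s\<in>I. G n s = 1 / \<kappa> (n - 1) s *
        (\<kappa> (n - 2) s * G (n - 2) s + deriv (G (n - 1)) s)"
      "\<forall>s\<in>I. (G n has_real_derivative - \<kappa> (n - 1) s * G (n - 1) s) (at s)"
      by blast
    then have G: "frenet_solution I n \<kappa> G" and G2: "\<forall>s\<in>I. G 2 s = 1"
      using iff[where G = G] by blast+
    obtain W where W: "\<And>s. s \<in> I \<Longrightarrow> (\<Sum>i=1..n. G i s *\<^sub>R V i s) = W"
      using frenet_solution_sum_constant[OF V G interval_I] by blast
    \<comment> \<open>Orthonormality singles out the coefficient \<open>G 2 = 1\<close>. This fixes
      the angle and also shows that \<open>W\<close> is nonzero.\<close>
    have V2: "V 2 s \<bullet> W = 1" "norm (V 2 s) = 1" if "s \<in> I" for s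
    proof -
      have on: "V 2 s \<bullet> V i s = (if i = 2 then 1 else 0)" if "i \<in> {1..n}" for i
        using frenet n_def n_ge that \<open>s \<in> I\<close> by (simp add: frenet_frame_def Let_def)
      have "V 2 s \<bullet> W = (\<Sum>i=1..n. G i s * (V 2 s \<bullet> V i s))"
        by (simp flip: W[OF that] add: inner_sum_right)
      also have "\<dots> = (\<Sum>i=1..n. if i = 2 then G i s else 0)"
        by (intro sum.cong) (auto simp: on)
      also have "\<dots> = 1" using n_ge G2 that by simp
      finally show "V 2 s \<bullet> W = 1" .
      show "norm (V 2 s) = 1" using on[of 2] n_ge by (simp add: norm_eq_1)
    qed
    show "slant_helix I V"
    proof (cases "I = {}")
      case True
      \<comment> \<open>On an empty interval any unit vector serves as axis, with angle 0.\<close>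
      obtain u :: "real ^ 'n" where "norm u = 1" using vector_choose_size[of 1] by auto
      then have "u \<bullet> u = 1" "cos (0 :: real) \<noteq> 0" by (simp_all add: norm_eq_1)
      then show ?thesis
        using True unfolding slant_helix_def slant_helix_with_angle_def by blast
    next
      case False
      then obtain s where "s \<in> I" by blast
      \<comment> \<open>Cauchy-Schwarz places \<open>1 / norm W\<close> in the domain of
        \<open>arccos\<close>, so it is the cosine of an actual angle.\<close>
      then have "1 \<le> norm W" using Cauchy_Schwarz_ineq2[of "V 2 s" W] V2 by simp
      then have c: "cos (arccos (1 / norm W)) = 1 / norm W"
        by (intro cos_arccos) (auto simp: divide_le_eq_1 intro: order_trans[of _ 0])
      have "W \<noteq> 0" using \<open>1 \<le> norm W\<close> by auto
      then have "sgn W \<bullet> sgn W = 1"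
        by (simp add: norm_sgn flip: norm_eq_1)
      moreover have "V 2 s \<bullet> sgn W = cos (arccos (1 / norm W))" if "s \<in> I" for s
        using V2(1)[OF that] c by (simp add: sgn_div_norm divide_inverse)
      moreover have "cos (arccos (1 / norm W)) \<noteq> 0" using c \<open>W \<noteq> 0\<close> by simp
      ultimately show ?thesis
        unfolding slant_helix_def slant_helix_with_angle_def by blast
    qed
  qed
qed

end
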